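(* For every positive integer $d$, one has $$\operatorname{rc}(\Delta_d)\le 5\left\lfloor\frac{d+1}{6}\right\rfloor+\bigl((d+1)\bmod 6\bigr),$$ where $\lfloor\cdot\rfloor$ denotes rounding down and $(d+1)\bmod 6$ is the remainder of the division of $d+1$ by $6$.
   Context: $\Delta_d=\{\mathbf{0},e_1,\dots,e_d\}\subset\mathbb{Z}^d$, where $e_1,\dots,e_d$ are the standard unit vectors of $\mathbb{R}^d$. A polyhedron is an intersection of finitely many closed half-spaces with arbitrary real (possibly irrational) coefficients; it may be unbounded. For $X\subseteq\mathbb{Z}^d$, a relaxation of $X$ is a polyhedron $Q\subseteq\mathbb{R}^d$ with $Q\cap\mathbb{Z}^d=X$. The relaxation complexity $\operatorname{rc}(X)$ is the minimal number of facets of a relaxation of $X$ ($\infty$ if no relaxation exists). *)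

theory Defs
  imports "HOL-Analysis.Analysis" "HOL-Library.Extended_Nat"
begin

definition integer_lattice :: "(real ^ 'n) set" where
  "integer_lattice = {x. \<forall>i. x $ i \<in> \<int>}"

definition is_relaxation :: "(real ^ 'n) set \<Rightarrow> (real ^ 'n) set \<Rightarrow> bool" where
  "is_relaxation Q X \<longleftrightarrow> polyhedron Q \<and> Q \<inter> integer_lattice = X"

text \<open>A polyhedron has finitely many facets (\<open>finite_polyhedron_facets\<close>), so \<open>card\<close> is the true
  number of facets. The infimum over the empty family is \<open>\<infinity>\<close>; over a nonempty family it is attained,
  as \<open>enat\<close> is well-ordered.\<close>

definition relaxation_complexity :: "(real ^ 'n) set \<Rightarrow> enat" where
  "relaxation_complexity X = (INF Q \<in> {Q. is_relaxation Q X}. enat (card {F. F facet_of Q}))"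

definition discrete_simplex :: "(real ^ 'n) set" where
  "discrete_simplex = insert 0 (range (\<lambda>i. axis i 1))"

end

theory Submission imports Defs begin

text \<open>Adding the coordinate \<open>x\<^sub>0 = 1 - (\<Sum>i. x\<^sub>i)\<close> turns the simplex into the set of unit vectors in
  the hyperplane of coordinate sum 1, and inequalities into linear forms. It suffices to find, on six
  coordinates, five nonnegative forms such that every integer point of coordinate sum at most 1 on which
  they are nonnegative lies in the positive orthant: disjoint blocks of coordinates can then be treated
  independently, with \<open>x\<^sub>j \<ge> 0\<close> for each of the remaining coordinates.

  For six coordinates, map the unit vectors to the vertices \<open>(t\<^sub>k, 0), (t\<^sub>k, 1)\<close> of a unimodular
  prism, \<open>t\<^sub>0, t\<^sub>1, t\<^sub>2\<close> being the vertices of a unimodular triangle. A bipyramid over a triangle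
  contains these six lattice points on its boundary, one in each of its six facets, and no others. It
  is the projection of a 4-simplex, and over its boundary the fibres are single points. With vertices in
  an irrational position, only one integer point of the plane over each of the six lattice points
  projects into the 4-simplex; its five facets are the five forms.\<close>

section \<open>Five forms on six coordinates\<close>

text \<open>If \<open>x \<le> -1\<close>, then \<beta> < \<alpha> forces
  \<open>y \<ge> 1 - x\<close> in the first form, and the second forces \<open>z \<ge> 1\<close>;
  the sum is then at least 2.\<close>

lemma cyclic_forms_imp_nonneg_aux:
  fixes x y z :: int and \<alpha> \<beta> \<gamma> \<epsilon> :: real
  assumes "0 < \<beta>" "\<beta> < \<alpha>" "0 < \<epsilon>" "0 < \<gamma>"
    and 1: "0 \<le> \<alpha> * x + \<beta> * y" and 2: "0 \<le> \<gamma> * z + \<epsilon> * x"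
    and "x + y + z \<le> 1"
  shows "0 \<le> x"
proof (rule ccontr)
  assume "\<not> 0 \<le> x"
  then have x: "x \<le> -1" by simp
  have "- x < y"
  proof (rule ccontr)
    assume "\<not> - x < y"
    then have "y \<le> - x" by simp
    then have "\<beta> * y \<le> \<beta> * - x"
      using assms(1) by (intro mult_left_mono) linarith+
    moreover have "(\<alpha> - \<beta>) * x < 0"
      using x assms(2) by (intro mult_pos_neg) auto
    ultimately show False using 1 by (simp add: algebra_simps)
  qed
  moreover have "0 < z"
  proof (rule ccontr)
    assume "\<not> 0 < z"
    then have "\<gamma> * z \<le> 0" using assms(4) by (intro mult_nonneg_nonpos) auto
    moreover have "\<epsilon> * x < 0" using x assms(3) by (intro mult_pos_neg) auto
    ultimately show False using 2 by simp
  qed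
  ultimately show False using assms(7) by linarith
qed

text \<open>Each variable carries a larger coefficient \<alpha> in one form and a smaller \<beta> in
  another, so the previous lemma applies to all three rotations.\<close>

lemma cyclic_forms_imp_nonneg:
  fixes x y z :: int and \<alpha>0 \<alpha>1 \<alpha>2 \<beta>0 \<beta>1 \<beta>2 :: real
  assumes "0 < \<beta>0" "\<beta>0 < \<alpha>0" "0 < \<beta>1" "\<beta>1 < \<alpha>1" "0 < \<beta>2" "\<beta>2 < \<alpha>2"
    and "0 \<le> \<alpha>0 * y + \<beta>0 * z" "0 \<le> \<alpha>1 * z + \<beta>1 * x" "0 \<le> \<alpha>2 * x + \<beta>2 * y"
    and "x + y + z \<le> 1"
  shows "0 \<le> x" "0 \<le> y" "0 \<le> z"
  using assms cyclic_forms_imp_nonneg_aux[of \<beta>2 \<alpha>2 \<beta>1 \<alpha>1 x y z]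
    cyclic_forms_imp_nonneg_aux[of \<beta>0 \<alpha>0 \<beta>2 \<alpha>2 y z x]
    cyclic_forms_imp_nonneg_aux[of \<beta>1 \<alpha>1 \<beta>0 \<alpha>0 z x y]
  by (simp_all add: add_ac)

text \<open>With \<open>d\<^sub>0 = 0\<close>, the forms are \<open>a = (\<Sum>i. (m + d\<^sub>i) u\<^sub>i)\<close> and
  \<open>c\<^sub>k = T\<^sub>k(l + u) + (\<Sum>i. (d\<^sub>k - d\<^sub>i) u\<^sub>i)\<close>, where \<open>T\<^sub>k\<close> are the cyclic forms above; the sums
  \<open>a + c\<^sub>k = T\<^sub>k(l + u) + (m + d\<^sub>k) (\<Sum>i. u\<^sub>i)\<close> are three of the facets of the bipyramid.
  Exchanging \<open>l\<close> with \<open>u\<close> and \<open>d\<close> with \<open>-d\<close> gives the other three.\<close>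

lemma six_coordinates_nonneg_half:
  fixes l0 l1 l2 u0 u1 u2 :: int and \<alpha>0 \<alpha>1 \<alpha>2 \<beta>0 \<beta>1 \<beta>2 m d1 d2 :: real
  assumes coeffs: "0 < \<beta>0" "\<beta>0 < \<alpha>0" "0 < \<beta>1" "\<beta>1 < \<alpha>1" "0 < \<beta>2" "\<beta>2 < \<alpha>2"
    and m: "0 < m" "0 < m + d1" "0 < m + d2"
    and indep: "\<And>p q. d1 * real_of_int p + d2 * real_of_int q = 0 \<Longrightarrow> p = 0 \<and> q = 0"
    and a: "0 \<le> m * (u0 + u1 + u2) + d1 * u1 + d2 * u2"
    and c0: "0 \<le> \<alpha>0 * (l1 + u1) + \<beta>0 * (l2 + u2) - (d1 * u1 + d2 * u2)"
    and c1: "0 \<le> \<alpha>1 * (l2 + u2) + \<beta>1 * (l0 + u0) + d1 * (u0 + u1 + u2) - (d1 * u1 + d2 * u2)"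
    and c2: "0 \<le> \<alpha>2 * (l0 + u0) + \<beta>2 * (l1 + u1) + d2 * (u0 + u1 + u2) - (d1 * u1 + d2 * u2)"
    and U: "u0 + u1 + u2 \<le> 0" and N: "l0 + l1 + l2 + u0 + u1 + u2 \<le> 1"
  shows "u0 = 0 \<and> u1 = 0 \<and> u2 = 0 \<and> 0 \<le> l0 \<and> 0 \<le> l1 \<and> 0 \<le> l2"
proof -
  define x y z V where xyz: "x = l0 + u0" "y = l1 + u1" "z = l2 + u2" "V = u0 + u1 + u2"
  define D where "D = d1 * u1 + d2 * u2"
  define T0 T1 T2 where T: "T0 = \<alpha>0 * y + \<beta>0 * z" "T1 = \<alpha>1 * z + \<beta>1 * x" "T2 = \<alpha>2 * x + \<beta>2 * y"
  have a': "0 \<le> m * V + D" using a by (simp add: xyz D_def)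
  have c': "D \<le> T0" "D \<le> T1 + d1 * V" "D \<le> T2 + d2 * V"
    using c0 c1 c2 by (simp_all add: xyz D_def T)
  have V: "V \<le> 0" using U by (simp add: xyz)
  have TV: "0 \<le> T0 + m * V" "0 \<le> T1 + (m + d1) * V" "0 \<le> T2 + (m + d2) * V"
    using a' c' by (simp_all add: algebra_simps)
  have mV: "m * V \<le> 0" "(m + d1) * V \<le> 0" "(m + d2) * V \<le> 0"
    using m V by (auto intro!: mult_nonneg_nonpos)
  have N': "x + y + z \<le> 1" using N by (simp add: xyz)
  have nonneg: "0 \<le> x" "0 \<le> y" "0 \<le> z"
    using cyclic_forms_imp_nonneg[OF coeffs, of y z x] TV mV N' unfolding T by linarith+
  \<comment> \<open>Two of three nonnegative integers of sum at most 1 vanish, and so does the form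
    \<open>Tk\<close> in these two. Then \<open>V\<close> must be 0, after which \<open>a'\<close>
    gives \<open>0 \<le> D\<close> and \<open>c'\<close> gives \<open>D \<le> 0\<close>.\<close>
  consider "y = 0" "z = 0" | "z = 0" "x = 0" | "x = 0" "y = 0"
    using nonneg N' by linarith
  then have "V = 0 \<and> D = 0"
  proof cases
    case 1
    then have "T0 = 0" by (simp add: T)
    then have "0 \<le> m * V" using TV by simp
    with V m(1) have "V = 0" by (simp add: zero_le_mult_iff)
    with a' c' \<open>T0 = 0\<close> show ?thesis by simp
  next
    case 2
    then have "T1 = 0" by (simp add: T)
    then have "0 \<le> (m + d1) * V" using TV by simp
    with V m(2) have "V = 0" by (simp add: zero_le_mult_iff)
    with a' c' \<open>T1 = 0\<close> show ?thesis by simp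
  next
    case 3
    then have "T2 = 0" by (simp add: T)
    then have "0 \<le> (m + d2) * V" using TV by simp
    with V m(3) have "V = 0" by (simp add: zero_le_mult_iff)
    with a' c' \<open>T2 = 0\<close> show ?thesis by simp
  qed
  \<comment> \<open>Irrationality enters here: \<open>indep\<close> turns \<open>D = 0\<close> into
    \<open>u1 = u2 = 0\<close>, and \<open>V = 0\<close> then kills \<open>u0\<close>.\<close>
  then have "u0 = 0 \<and> u1 = 0 \<and> u2 = 0"
    using indep[of u1 u2] by (auto simp: D_def xyz)
  then show ?thesis using nonneg by (simp add: xyz)
qed

lemma sqrt2_int_independent:
  fixes p q :: int
  assumes "p + sqrt 2 * q = 0"
  shows "p = 0 \<and> q = 0"
proof -
  have "real_of_int p = - (sqrt 2 * q)" using assms by linarith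
  then have "(real_of_int p)\<^sup>2 = 2 * (real_of_int q)\<^sup>2" by (simp add: power_mult_distrib)
  then have "real_of_int (p\<^sup>2) = real_of_int (2 * q\<^sup>2)" by simp
  then have sq: "p\<^sup>2 = 2 * q\<^sup>2" by (simp only: of_int_eq_iff)
  have "q = 0"
  proof (rule ccontr)
    assume q: "q \<noteq> 0"
    with sq have p: "p \<noteq> 0" by auto
    \<comment> \<open>The exponent of 2 is even on one side of \<open>sq\<close> and odd on the
      other.\<close>
    have "prime_elem (2 :: int)" by simp
    then have "multiplicity 2 (p\<^sup>2) = 2 * multiplicity 2 p"
      "multiplicity 2 (2 * q\<^sup>2) = Suc (2 * multiplicity 2 q)"
      using p q by (simp_all add: prime_elem_multiplicity_mult_distrib
          prime_elem_multiplicity_power_distrib)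
    with sq show False by presburger
  qed
  with assms show ?thesis by simp
qed

text \<open>These are the forms above with all \<alpha> = 6, all \<beta> = 2, \<open>m = 2\<close>,
  \<open>d1 = 1\<close>, \<open>d2 = sqrt 2\<close>; \<open>b\<close> is \<open>a\<close> after the
  exchange of \<open>l\<close> and \<open>u\<close>. The sums over \<open>l\<close> and over
  \<open>u\<close> cannot both be positive, so one of the two halves applies.\<close>

lemma six_coordinates_nonneg:
  fixes l0 l1 l2 u0 u1 u2 :: int
  assumes a: "0 \<le> 2 * u0 + 3 * u1 + (2 + sqrt 2) * u2"
    and b: "0 \<le> 2 * l0 + l1 + (2 - sqrt 2) * l2"
    and c0: "0 \<le> 6 * l1 + 2 * l2 + 5 * u1 + (2 - sqrt 2) * u2"
    and c1: "0 \<le> 2 * l0 + 6 * l2 + 3 * u0 + (7 - sqrt 2) * u2"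
    and c2: "0 \<le> 6 * l0 + 2 * l1 + (6 + sqrt 2) * u0 + (1 + sqrt 2) * u1"
    and N: "l0 + l1 + l2 + u0 + u1 + u2 \<le> 1"
  shows "0 \<le> l0 \<and> 0 \<le> l1 \<and> 0 \<le> l2 \<and> 0 \<le> u0 \<and> 0 \<le> u1 \<and> 0 \<le> u2"
proof -
  have s: "1 < sqrt 2" "sqrt 2 < 3/2"
    by (simp, rule real_less_lsqrt) (simp_all add: power2_eq_square)
  consider "u0 + u1 + u2 \<le> 0" | "l0 + l1 + l2 \<le> 0" using N by linarith
  then show ?thesis
  proof cases
    case 1
    have "u0 = 0 \<and> u1 = 0 \<and> u2 = 0 \<and> 0 \<le> l0 \<and> 0 \<le> l1 \<and> 0 \<le> l2"
    proof (rule six_coordinates_nonneg_half[where ?\<alpha>0.0 = 6 and ?\<alpha>1.0 = 6 and ?\<alpha>2.0 = 6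
          and ?\<beta>0.0 = 2 and ?\<beta>1.0 = 2 and ?\<beta>2.0 = 2 and m = 2 and ?d1.0 = 1 and ?d2.0 = "sqrt 2"])
      show "p = 0 \<and> q = 0" if "1 * real_of_int p + sqrt 2 * real_of_int q = 0" for p q
        using sqrt2_int_independent[of p q] that by simp
    qed (use 1 assms s in \<open>simp_all add: algebra_simps add_pos_pos\<close>)
    then show ?thesis by simp
  next
    case 2
    have "l0 = 0 \<and> l1 = 0 \<and> l2 = 0 \<and> 0 \<le> u0 \<and> 0 \<le> u1 \<and> 0 \<le> u2"
    \<comment> \<open>After the exchange, \<alpha> and \<beta> are the coefficients of
      \<open>u\<close> in \<open>c0\<close>, \<open>c1\<close>, \<open>c2\<close>, as those of
      \<open>l\<close> were before.\<close>
    proof (rule six_coordinates_nonneg_half[where ?\<alpha>0.0 = 5 and ?\<alpha>1.0 = "7 - sqrt 2"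
          and ?\<alpha>2.0 = "6 + sqrt 2" and ?\<beta>0.0 = "2 - sqrt 2" and ?\<beta>1.0 = 3 and ?\<beta>2.0 = "1 + sqrt 2"
          and m = 2 and ?d1.0 = "-1" and ?d2.0 = "- sqrt 2"])
      show "p = 0 \<and> q = 0" if "- 1 * real_of_int p + - sqrt 2 * real_of_int q = 0" for p q
        using sqrt2_int_independent[of p q] that by simp
    qed (use 2 assms s in \<open>simp_all add: algebra_simps add_pos_pos\<close>)
    then show ?thesis by simp
  qed
qed

section \<open>Systems of forms on arbitrary coordinate sets\<close>

text \<open>The forms in \<open>W\<close> cut out a cone in \<open>\<real>\<^sup>J\<close> whose integer points of coordinate sum at most 1 are
  0 and the unit vectors. Controlling sums below 1 as well makes the property additive.\<close>

definition simplex_forms :: "'i set \<Rightarrow> ('i \<Rightarrow> real) set \<Rightarrow> bool" where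
  "simplex_forms J W \<longleftrightarrow> finite W \<and> (\<forall>w\<in>W. \<forall>j\<in>J. 0 \<le> w j) \<and>
    (\<forall>y :: 'i \<Rightarrow> int. (\<forall>w\<in>W. 0 \<le> (\<Sum>j\<in>J. w j * real_of_int (y j))) \<longrightarrow> sum y J \<le> 1
       \<longrightarrow> (\<forall>j\<in>J. 0 \<le> y j))"

lemma simplex_forms_empty: "simplex_forms {} {}"
  by (simp add: simplex_forms_def)

lemma simplex_forms_singleton: "simplex_forms {i} {\<lambda>_. 1}"
  by (simp add: simplex_forms_def)

text \<open>Forms on disjoint blocks are extended by zero and do not interact.\<close>

lemma simplex_forms_Un:
  assumes 1: "simplex_forms J1 W1" and 2: "simplex_forms J2 W2"
    and fin: "finite J1" "finite J2" and disj: "J1 \<inter> J2 = {}"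
  obtains W where "simplex_forms (J1 \<union> J2) W" "card W \<le> card W1 + card W2"
proof -
  define ext where "ext J w j = (if j \<in> J then w j else 0)" for J and w :: "'a \<Rightarrow> real" and j
  define W where "W = ext J1 ` W1 \<union> ext J2 ` W2"
  have finW: "finite W1" "finite W2" using 1 2 by (simp_all add: simplex_forms_def)
  have "card W \<le> card W1 + card W2"
    unfolding W_def using finW
    by (meson add_mono card_Un_le card_image_le order_trans)
  moreover have "simplex_forms (J1 \<union> J2) W"
    unfolding simplex_forms_def
  proof (intro conjI allI impI)
    show "finite W" using finW by (simp add: W_def)
    show "\<forall>w\<in>W. \<forall>j\<in>J1 \<union> J2. 0 \<le> w j"
      using 1 2 by (auto simp: W_def ext_def simplex_forms_def)
    fix y :: "'a \<Rightarrow> int"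
    assume ge: "\<forall>w\<in>W. 0 \<le> (\<Sum>j\<in>J1 \<union> J2. w j * real_of_int (y j))" and le: "sum y (J1 \<union> J2) \<le> 1"
    have ext1: "(\<Sum>j\<in>J1 \<union> J2. ext J1 w j * real_of_int (y j)) = (\<Sum>j\<in>J1. w j * real_of_int (y j))" for w
      using fin by (intro sum.mono_neutral_cong_right) (auto simp: ext_def)
    have ext2: "(\<Sum>j\<in>J1 \<union> J2. ext J2 w j * real_of_int (y j)) = (\<Sum>j\<in>J2. w j * real_of_int (y j))" for w
      using fin by (intro sum.mono_neutral_cong_right) (auto simp: ext_def)
    have W1: "\<forall>w\<in>W1. 0 \<le> (\<Sum>j\<in>J1. w j * real_of_int (y j))"
      using ge by (simp add: W_def ball_Un ext1)
    have W2: "\<forall>w\<in>W2. 0 \<le> (\<Sum>j\<in>J2. w j * real_of_int (y j))"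
      using ge by (simp add: W_def ball_Un ext2)
    have nonneg1: "\<forall>j\<in>J1. 0 \<le> y j" if "sum y J1 \<le> 1"
      using 1 W1 that unfolding simplex_forms_def by blast
    have nonneg2: "\<forall>j\<in>J2. 0 \<le> y j" if "sum y J2 \<le> 1"
      using 2 W2 that unfolding simplex_forms_def by blast
    have "sum y J1 + sum y J2 \<le> 1"
      using le fin disj by (simp add: sum.union_disjoint)
    \<comment> \<open>If one partial sum exceeded 1, the other would be negative, yet small enough
      for its forms to make \<open>y\<close> nonnegative there.\<close>
    then have "sum y J1 \<le> 1 \<and> sum y J2 \<le> 1"
      using sum_nonneg[of J1 y] sum_nonneg[of J2 y] nonneg1 nonneg2 by fastforce
    then show "\<forall>j\<in>J1 \<union> J2. 0 \<le> y j"
      using nonneg1 nonneg2 by blast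
  qed
  ultimately show ?thesis by (rule that[rotated])
qed

lemma simplex_forms_six:
  assumes "card J = 6"
  obtains W where "simplex_forms J W" "card W \<le> 5"
proof -
  have "finite J" using assms by (metis card.infinite zero_neq_numeral)
  then obtain e where e: "bij_betw e {..<6::nat} J"
    using assms by (metis card_lessThan finite_lessThan finite_same_card_bij)
  define g where "g = the_inv_into {..<6} e"
  have ge: "g (e i) = i" if "i < 6" for i
    using e that by (simp add: g_def the_inv_into_f_f bij_betw_def)
  \<comment> \<open>The rows are \<open>a\<close>, \<open>b\<close>, \<open>c0\<close>,
    \<open>c1\<close>, \<open>c2\<close>, with columns in the order
    \<open>l0, l1, l2, u0, u1, u2\<close>; \<open>g\<close> finds the column of a
    coordinate.\<close>
  define R :: "real list list" where "R =
    [[0, 0, 0, 2, 3, 2 + sqrt 2],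
     [2, 1, 2 - sqrt 2, 0, 0, 0],
     [0, 6, 2, 0, 5, 2 - sqrt 2],
     [2, 0, 6, 3, 0, 7 - sqrt 2],
     [6, 2, 0, 6 + sqrt 2, 1 + sqrt 2, 0]]"
  define W where "W = set (map (\<lambda>r j. r ! g j) R)"
  have s: "sqrt 2 < 2"
    by (rule real_less_lsqrt) (simp_all add: power2_eq_square)
  have six: "{..<6::nat} = {0, 1, 2, 3, 4, 5}" by auto
  have J: "J = e ` {..<6}" using e by (simp add: bij_betw_def)
  have sumJ: "(\<Sum>j\<in>J. f j) = f (e 0) + f (e 1) + f (e 2) + f (e 3) + f (e 4) + f (e 5)"
    for f :: "'a \<Rightarrow> 'b::comm_monoid_add"
    using sum.reindex_bij_betw[OF e, of f] unfolding six by (simp add: add_ac)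
  have "simplex_forms J W"
    unfolding simplex_forms_def
  proof (intro conjI allI impI)
    show "finite W" by (simp add: W_def)
    show "\<forall>w\<in>W. \<forall>j\<in>J. 0 \<le> w j"
      using s by (simp add: W_def J six R_def ge)
    fix y :: "'a \<Rightarrow> int"
    assume nn: "\<forall>w\<in>W. 0 \<le> (\<Sum>j\<in>J. w j * real_of_int (y j))" and "sum y J \<le> 1"
    have row: "0 \<le> (\<Sum>j\<in>J. r ! g j * real_of_int (y j))" if "r \<in> set R" for r
      using nn that by (simp add: W_def)
    have "0 \<le> y (e 0) \<and> 0 \<le> y (e 1) \<and> 0 \<le> y (e 2) \<and> 0 \<le> y (e 3) \<and> 0 \<le> y (e 4) \<and> 0 \<le> y (e 5)"
    proof (rule six_coordinates_nonneg)
      show "y (e 0) + y (e 1) + y (e 2) + y (e 3) + y (e 4) + y (e 5) \<le> 1"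
        using \<open>sum y J \<le> 1\<close> by (simp add: sumJ)
    qed (use row[of "R ! 0"] row[of "R ! 1"] row[of "R ! 2"] row[of "R ! 3"] row[of "R ! 4"]
        in \<open>simp_all add: sumJ ge R_def\<close>)
    then show "\<forall>j\<in>J. 0 \<le> y j" by (simp add: J six)
  qed
  moreover have "card W \<le> 5"
    unfolding W_def by (rule order_trans[OF card_length]) (simp add: R_def)
  ultimately show ?thesis by (rule that)
qed

text \<open>Blocks of six coordinates are split off at a cost of five forms each; fewer than six
  left over cost one form each.\<close>

lemma simplex_forms_exist:
  assumes "finite J"
  shows "\<exists>W. simplex_forms J W \<and> card W \<le> 5 * (card J div 6) + card J mod 6"
  using assms
proof (induction "card J" arbitrary: J rule: less_induct)
  case less
  consider "J = {}" | "0 < card J" "card J < 6" | "6 \<le> card J"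
    using less.prems by (metis card_gt_0_iff not_le)
  then show ?case
  proof cases
    case 1
    then show ?thesis using simplex_forms_empty by (intro exI[of _ "{}"]) simp
  next
    case 2
    then obtain i where i: "i \<in> J" by fastforce
    have card: "card (J - {i}) = card J - 1" "finite (J - {i})" using i less.prems by auto
    with less.hyps[of "J - {i}"] 2
    obtain W where W: "simplex_forms (J - {i}) W" "card W \<le> card J - 1" by auto
    obtain W' where "simplex_forms ({i} \<union> (J - {i})) W'" "card W' \<le> card {\<lambda>_::'a. 1::real} + card W"
      using simplex_forms_Un[OF simplex_forms_singleton W(1)] card(2) by blast
    moreover have "{i} \<union> (J - {i}) = J" using i by blast
    ultimately show ?thesis using W 2 by (intro exI[of _ W']) auto
  next
    case 3
    then obtain K where K: "K \<subseteq> J" "card K = 6" by (meson obtain_subset_with_card_n)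
    obtain W1 where W1: "simplex_forms K W1" "card W1 \<le> 5"
      using simplex_forms_six[OF K(2)] by blast
    have fin: "finite K" "finite (J - K)" using K less.prems finite_subset by auto
    have card: "card J = card (J - K) + 6"
      using K 3 fin by (simp add: card_Diff_subset)
    with less.hyps[of "J - K"] fin
    obtain W where W: "simplex_forms (J - K) W"
      "card W \<le> 5 * (card (J - K) div 6) + card (J - K) mod 6" by auto
    obtain W' where "simplex_forms (K \<union> (J - K)) W'" "card W' \<le> card W1 + card W"
      using simplex_forms_Un[OF W1(1) W(1) fin] by blast
    moreover have "K \<union> (J - K) = J" using K by blast
    ultimately show ?thesis using W W1 card by (intro exI[of _ W']) auto
  qed
qed

section \<open>From forms to facets of a relaxation\<close>

text \<open>A smallest subfamily that cuts out the polyhedron within its affine hull is irredundant,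
  so each facet lies on the boundary of one of its members.\<close>

lemma card_facets_le_card_halfspaces:
  fixes \<H> :: "'a::euclidean_space set set"
  assumes fin: "finite \<H>" and half: "\<And>h. h \<in> \<H> \<Longrightarrow> \<exists>a b. h = {x. a \<bullet> x \<le> b}"
    and ne: "\<Inter>\<H> \<noteq> {}"
  shows "card {F. F facet_of \<Inter>\<H>} \<le> card \<H>"
proof -
  define S where "S = \<Inter>\<H>"
  have hull: "S \<subseteq> affine hull S" by (rule hull_subset)
  define good where "good \<G> \<longleftrightarrow> \<G> \<subseteq> \<H> \<and> S = affine hull S \<inter> \<Inter>\<G>" for \<G>
  have "good \<H>" using hull by (auto simp: good_def S_def)
  then obtain \<G> where \<G>: "good \<G>" and min: "\<And>\<G>'. good \<G>' \<Longrightarrow> card \<G> \<le> card \<G>'"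
    using ex_has_least_nat[of good \<H> card] by blast
  have fin\<G>: "finite \<G>" using \<G> fin finite_subset by (auto simp: good_def)
  have psub: "S \<subset> affine hull S \<inter> \<Inter>\<G>'" if "\<G>' \<subset> \<G>" for \<G>'
  proof -
    have "card \<G>' < card \<G>" using that fin\<G> psubset_card_mono by blast
    then have "\<not> good \<G>'" using min leD by blast
    moreover have "S \<subseteq> affine hull S \<inter> \<Inter>\<G>'" "\<G>' \<subseteq> \<H>" using \<G> that by (auto simp: good_def)
    ultimately show ?thesis by (auto simp: good_def)
  qed
  have "\<exists>a b. a \<noteq> 0 \<and> h = {x. a \<bullet> x \<le> b}" if h: "h \<in> \<G>" for h
  proof -
    obtain a b where ab: "h = {x. a \<bullet> x \<le> b}" using half h \<G> unfolding good_def by blast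
    have "a \<noteq> 0"
    proof
      \<comment> \<open>A zero normal would make the nonempty \<open>h\<close> the whole space, so
        it could be dropped against minimality.\<close>
      assume "a = 0"
      moreover have "h \<noteq> {}" using ne h \<G> by (auto simp: good_def)
      ultimately have "h = UNIV" using ab by auto
      then have "affine hull S \<inter> \<Inter>(\<G> - {h}) = S" using \<G> h by (auto simp: good_def)
      then show False using psub[of "\<G> - {h}"] h by blast
    qed
    with ab show ?thesis by blast
  qed
  then obtain a b where ab: "\<And>h. h \<in> \<G> \<Longrightarrow> a h \<noteq> 0 \<and> h = {x. a h \<bullet> x \<le> b h}" by metis
  have "{F. F facet_of S} = (\<lambda>h. S \<inter> {x. a h \<bullet> x = b h}) ` \<G>"
    using facet_of_polyhedron_explicit[OF fin\<G> _ ab psub] \<G> by (auto simp: good_def)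
  then have "card {F. F facet_of S} \<le> card \<G>" using fin\<G> by (simp add: card_image_le)
  also have "\<dots> \<le> card \<H>" using \<G> fin by (auto simp: good_def intro: card_mono)
  finally show ?thesis by (simp add: S_def)
qed

lemma nonneg_int_sum_eq_1_unit_vector:
  fixes y :: "'a::finite \<Rightarrow> int"
  assumes "\<And>j. 0 \<le> y j" "(\<Sum>j\<in>UNIV. y j) = 1"
  obtains j where "y j = 1" "\<And>k. k \<noteq> j \<Longrightarrow> y k = 0"
proof -
  obtain j where j: "y j \<noteq> 0" using assms(2) by (metis sum.neutral zero_neq_one)
  have split: "sum y UNIV = y j + sum y (UNIV - {j})" by (simp add: sum.remove)
  have "0 \<le> sum y (UNIV - {j})" using assms(1) by (simp add: sum_nonneg)
  then have "y j = 1" and 0: "sum y (UNIV - {j}) = 0"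
    using split assms(2) j assms(1)[of j] by linarith+
  moreover have "y k = 0" if "k \<noteq> j" for k
    using 0 that assms(1) by (simp add: sum_nonneg_eq_0_iff)
  ultimately show ?thesis using that by blast
qed

lemma relaxation_complexity_discrete_simplex_le:
  fixes W :: "('n::finite option \<Rightarrow> real) set"
  assumes W: "simplex_forms UNIV W"
  shows "relaxation_complexity (discrete_simplex :: (real ^ 'n) set) \<le> enat (card W)"
proof -
  \<comment> \<open>Barycentric coordinates with respect to the vertices of the simplex:
    \<open>None\<close> belongs to the origin, \<open>Some i\<close> to the i-th unit
    vector.\<close>
  define hom where "hom x j = (case j of None \<Rightarrow> 1 - (\<Sum>i\<in>UNIV. x $ i) | Some i \<Rightarrow> x $ i)"
    for x :: "real ^ 'n" and j
  define H where "H w = {x :: real ^ 'n. 0 \<le> (\<Sum>j\<in>UNIV. w j * hom x j)}" for w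
  define Q where "Q = \<Inter>(H ` W)"
  have finW: "finite W" using W by (simp add: simplex_forms_def)
  have UNIV_opt: "(\<Sum>j\<in>UNIV. f j) = f None + (\<Sum>i\<in>UNIV. f (Some i))"
    for f :: "'n option \<Rightarrow> 'b::comm_monoid_add"
    by (simp add: UNIV_option_conv sum.reindex)
  have half: "\<exists>a b. H w = {x. a \<bullet> x \<le> b}" for w
  proof -
    have "(\<Sum>j\<in>UNIV. w j * hom x j) = w None - (\<chi> i. w None - w (Some i)) \<bullet> x" for x
      by (simp add: UNIV_opt hom_def inner_vec_def algebra_simps sum_subtractf sum_distrib_left)
    then have "H w = {x. (\<chi> i. w None - w (Some i)) \<bullet> x \<le> w None}"
      by (simp add: H_def)
    then show ?thesis by blast
  qed
  have "polyhedron (H w)" for w using half[of w] polyhedron_halfspace_le by metis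
  then have poly: "polyhedron Q" using finW by (auto simp: Q_def intro: polyhedron_Inter)
  have hom0: "hom 0 j = of_bool (j = None)" for j by (simp add: hom_def split: option.split)
  have hom1: "hom (axis i 1) j = of_bool (j = Some i)" for i j
    by (auto simp: hom_def axis_def split: option.split)
  \<comment> \<open>The vertices have unit vectors as coordinates, so nonnegative coefficients of
    the forms suffice.\<close>
  have sub: "discrete_simplex \<subseteq> Q"
    using W by (auto simp: discrete_simplex_def Q_def H_def hom0 hom1 simplex_forms_def
        intro!: sum_nonneg)
  have "Q \<inter> integer_lattice = discrete_simplex"
  proof (intro equalityI subsetI IntI)
    fix x :: "real ^ 'n" assume "x \<in> discrete_simplex"
    then show "x \<in> Q" "x \<in> integer_lattice"
      using sub by (auto simp: discrete_simplex_def integer_lattice_def axis_def)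
  next
    fix x :: "real ^ 'n" assume x: "x \<in> Q \<inter> integer_lattice"
    \<comment> \<open>The floor only changes the type, as \<open>hom x j\<close> is an
      integer.\<close>
    define y where "y j = \<lfloor>hom x j\<rfloor>" for j
    have "hom x j \<in> \<int>" for j
      using x by (auto simp: hom_def integer_lattice_def split: option.split)
    then have y: "real_of_int (y j) = hom x j" for j by (simp add: y_def)
    have "real_of_int (\<Sum>j\<in>UNIV. y j) = (\<Sum>j\<in>UNIV. hom x j)" by (simp add: y)
    also have "\<dots> = 1" by (simp add: UNIV_opt hom_def)
    finally have sum1: "(\<Sum>j\<in>UNIV. y j) = 1" by (simp only: of_int_eq_1_iff)
    have "\<forall>w\<in>W. 0 \<le> (\<Sum>j\<in>UNIV. w j * real_of_int (y j))" using x by (simp add: Q_def H_def y)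
    then have "\<And>j. 0 \<le> y j" using W sum1 unfolding simplex_forms_def by (metis UNIV_I order_refl)
    then obtain k where k: "y k = 1" "\<And>j. j \<noteq> k \<Longrightarrow> y j = 0"
      using nonneg_int_sum_eq_1_unit_vector sum1 by blast
    have xi: "x $ i = of_bool (Some i = k)" for i
      using y[of "Some i"] k by (cases "Some i = k") (auto simp: hom_def)
    show "x \<in> discrete_simplex"
    proof (cases k)
      case None
      then have "x = 0" using xi by (simp add: vec_eq_iff)
      then show ?thesis by (simp add: discrete_simplex_def)
    next
      case (Some i)
      then have "x = axis i 1" using xi by (auto simp: vec_eq_iff axis_def)
      then show ?thesis by (simp add: discrete_simplex_def)
    qed
  qed
  with poly have "is_relaxation Q discrete_simplex" by (simp add: is_relaxation_def)
  then have "relaxation_complexity (discrete_simplex :: (real ^ 'n) set) \<le> enat (card {F. F facet_of Q})"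
    unfolding relaxation_complexity_def by (intro INF_lower) simp
  moreover have "card {F. F facet_of Q} \<le> card (H ` W)"
    unfolding Q_def
  proof (rule card_facets_le_card_halfspaces)
    show "\<Inter>(H ` W) \<noteq> {}" using sub by (auto simp: Q_def discrete_simplex_def)
  qed (use finW half in auto)
  moreover have "card (H ` W) \<le> card W" using finW by (rule card_image_le)
  ultimately show ?thesis by (meson enat_ord_simps(1) order_trans)
qed

theorem corollary2:
  "relaxation_complexity (discrete_simplex :: (real ^ 'n) set)
     \<le> enat (5 * ((CARD('n) + 1) div 6) + (CARD('n) + 1) mod 6)"
proof -
  obtain W where "simplex_forms (UNIV :: 'n option set) W"
    "card W \<le> 5 * ((CARD('n) + 1) div 6) + (CARD('n) + 1) mod 6"
    using simplex_forms_exist[of "UNIV :: 'n option set"] by (auto simp: card_UNIV_option)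
  then show ?thesis
    using relaxation_complexity_discrete_simplex_le by (meson enat_ord_simps(1) order_trans)
qed

end
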